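(* Given real numbers $b,d,f$ and nonnegative real numbers $a,c,e$, define the function $$F(x)=\sqrt[x]{\frac{\Gamma(ax+b+1)}{\Gamma(cx+d+1)\,\Gamma(ex+f+1)}}.$$ (i) If $a>c+e$, then $F(x)$ is an asymptotically log-concave function. (ii) Assume $a=c+e$. If $c\geq e>0$ and $b<d+f+1/2$, then $F(x)$ is an asymptotically log-concave function. In particular, if $c\geq 1$ and $b=d=f=0$, then $F(x)$ is a log-concave function for $x\geq 30$; if $c\geq 1$, $b=d=0$ and $f\geq 1$, then $F(x)$ is a log-concave function for $x\geq 2$. (iii) Assume $a=c+e$. If $c>e=0$ and $b<d$, then $F(x)$ is an asymptotically log-concave function. (iv) If $a<c+e$, then $F(x)$ is an asymptotically log-convex function.
   Context: $\Gamma$ is the Euler Gamma function, and $\sqrt[x]{y}$ means $y^{1/x}$. A positive function is log-concave (resp. log-convex) on an interval if its logarithm is concave (resp. convex) there. A function is asymptotically log-concave (resp. asymptotically log-convex) if it is log-concave (resp. log-convex) for all sufficiently large $x$. *)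

theory Defs
  imports "HOL-Analysis.Analysis"
begin

text \<open>
  \<^const>\<open>Gamma\<close> is \<open>0\<close> at its poles and division by \<open>0\<close> yields \<open>0\<close>. Hence
  \<open>Gamma_ratio a b c d e f x > 0\<close> holds exactly if the three Gamma values exist and
  the quotient is positive.
\<close>

definition Gamma_ratio :: "real \<Rightarrow> real \<Rightarrow> real \<Rightarrow> real \<Rightarrow> real \<Rightarrow> real \<Rightarrow> real \<Rightarrow> real" where
  "Gamma_ratio a b c d e f x =
     Gamma (a * x + b + 1) / (Gamma (c * x + d + 1) * Gamma (e * x + f + 1))"

text \<open>
  The \<open>x\<close>-th root has a real index, so it is a real power. It has its usual meaning only
  for \<open>x \<noteq> 0\<close> and a positive radicand; for a negative radicand the value of
  \<open>powr\<close> is a convention.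
\<close>

definition Gamma_root :: "real \<Rightarrow> real \<Rightarrow> real \<Rightarrow> real \<Rightarrow> real \<Rightarrow> real \<Rightarrow> real \<Rightarrow> real" where
  "Gamma_root a b c d e f x = Gamma_ratio a b c d e f x powr (1 / x)"

definition log_concave_on :: "real set \<Rightarrow> (real \<Rightarrow> real) \<Rightarrow> bool" where
  "log_concave_on S g \<longleftrightarrow> (\<forall>x\<in>S. g x > 0) \<and> concave_on S (\<lambda>x. ln (g x))"

definition log_convex_on :: "real set \<Rightarrow> (real \<Rightarrow> real) \<Rightarrow> bool" where
  "log_convex_on S g \<longleftrightarrow> (\<forall>x\<in>S. g x > 0) \<and> convex_on S (\<lambda>x. ln (g x))"

definition asymptotically_log_concave :: "(real \<Rightarrow> real) \<Rightarrow> bool" where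
  "asymptotically_log_concave g \<longleftrightarrow> (\<exists>X. log_concave_on {X..} g)"

definition asymptotically_log_convex :: "(real \<Rightarrow> real) \<Rightarrow> bool" where
  "asymptotically_log_convex g \<longleftrightarrow> (\<exists>X. log_convex_on {X..} g)"

end

theory Submission
  imports Defs "HOL-Real_Asymp.Real_Asymp"
begin

text \<open>
  Write \<open>\<Phi>\<^sub>b(y) = y\<^sup>2 \<psi>'(y+b+1) - 2 y \<psi>(y+b+1) + 2 ln \<bar>\<Gamma>(y+b+1)\<bar>\<close>. Then
  \<open>(ln F)''(x) = (\<Phi>\<^sub>b(ax) - \<Phi>\<^sub>d(cx) - \<Phi>\<^sub>f(ex)) / x\<^sup>3\<close>, and differentiating cancels
  all but one term: \<open>\<Phi>\<^sub>b'(y) = y\<^sup>2 \<psi>''(y+b+1)\<close>. Telescoping estimates of the series of \<open>\<psi>''\<close> give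
  \<open>y \<Phi>\<^sub>b'(y) = -y + 2b + 1 + o(1)\<close>. Hence the numerator \<open>\<phi>\<close> of \<open>(ln F)''\<close> satisfies
  \<open>x \<phi>'(x) = -(a-c-e) x + const + o(1)\<close>, and if this stays away from \<open>0\<close> then \<open>\<phi>\<close> grows at
  least logarithmically in absolute value, with the same sign.

  For the explicit ranges, \<open>\<Phi>\<^sub>0(0) = 0\<close> and \<open>\<Phi>\<^sub>0\<close> is concave on the nonnegative reals, hence
  subadditive; and \<open>\<Phi>\<^sub>f \<ge> \<Phi>\<^sub>0\<close> for \<open>f \<ge> 1\<close> because \<open>\<psi>''\<close> increases.
\<close>

section \<open>Bounds for \<open>Polygamma 2\<close> and \<open>Polygamma 3\<close> by telescoping
  their series\<close>

lemma sums_le_telescope: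
  fixes f g :: "nat \<Rightarrow> real"
  assumes "f sums s" "g \<longlonglongrightarrow> 0" "\<And>k. f k \<le> g k - g (Suc k)"
  shows "s \<le> g 0"
  using sums_le[OF assms(3,1) telescope_sums'[OF assms(2)]] by simp

lemma sums_ge_telescope:
  fixes f g :: "nat \<Rightarrow> real"
  assumes "f sums s" "g \<longlonglongrightarrow> 0" "\<And>k. g k - g (Suc k) \<le> f k"
  shows "g 0 \<le> s"
  using sums_le[OF assms(3) telescope_sums'[OF assms(2)] assms(1)] by simp

lemma Polygamma_2_sums:
  fixes z :: real
  assumes "z > 0"
  shows "(\<lambda>k. 2 / (z + real k) ^ 3) sums (- Polygamma 2 z)"
  using sums_mult[OF Polygamma_LIMSEQ[of z 2], of 2] assms
  by (simp add: eval_nat_numeral field_simps)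

lemma Polygamma_3_sums:
  fixes z :: real
  assumes "z > 0"
  shows "(\<lambda>k. 6 / (z + real k) ^ 4) sums Polygamma 3 z"
  using sums_mult[OF Polygamma_LIMSEQ[of z 3], of 6] assms
  by (simp add: eval_nat_numeral field_simps)

lemma Polygamma_2_upper:
  fixes z :: real
  assumes "z > 0"
  shows "Polygamma 2 z \<le> - (1 / z\<^sup>2 + 1 / z ^ 3)"
proof -
  define T where "T = (\<lambda>z::real. 1 / z\<^sup>2 + 1 / z ^ 3)"
  \<comment> \<open>\<open>T\<close> is the beginning of the asymptotic expansion of \<open>-\<psi>''\<close>\<close>
  have step: "T w - T (w + 1) \<le> 2 / w ^ 3" if "w > 0" for w
  proof -
    have "2 / w ^ 3 - (T w - T (w + 1)) = (2 * w + 1) / (w ^ 3 * (w + 1) ^ 3)"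
      using that unfolding T_def by (simp add: divide_simps) algebra
    moreover have "\<dots> \<ge> 0" using that by simp
    ultimately show ?thesis by linarith
  qed
  have "(\<lambda>k. T (z + real k)) \<longlonglongrightarrow> 0"
    unfolding T_def by real_asymp
  from sums_ge_telescope[OF Polygamma_2_sums[OF assms] this] step[of "z + real _"] assms
  have "T (z + real 0) \<le> - Polygamma 2 z"
    by (simp add: add_ac)
  thus ?thesis by (simp add: T_def)
qed

text \<open>The asymptotic expansion of -\<psi>'' continues with 1/(2 z^4). Raising that coefficient
  to 1 makes \<open>U\<close> an overestimate whose differences dominate the series term by
  term.\<close>

lemma Polygamma_2_lower:
  fixes z :: real
  assumes "z > 0"
  shows "Polygamma 2 z \<ge> - (1 / z\<^sup>2 + 1 / z ^ 3 + 1 / z ^ 4)"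
proof -
  define U where "U = (\<lambda>z::real. 1 / z\<^sup>2 + 1 / z ^ 3 + 1 / z ^ 4)"
  have step: "2 / w ^ 3 \<le> U w - U (w + 1)" if "w > 0" for w
  proof -
    have "U w - U (w + 1) - 2 / w ^ 3 = (2 * w ^ 3 + 3 * w\<^sup>2 + 3 * w + 1) / (w ^ 4 * (w + 1) ^ 4)"
      using that unfolding U_def by (simp add: divide_simps) algebra
    moreover have "\<dots> \<ge> 0" using that by simp
    ultimately show ?thesis by linarith
  qed
  have "(\<lambda>k. U (z + real k)) \<longlonglongrightarrow> 0"
    unfolding U_def by real_asymp
  from sums_le_telescope[OF Polygamma_2_sums[OF assms] this] step[of "z + real _"] assms
  have "- Polygamma 2 z \<le> U (z + real 0)"
    by (simp add: add_ac)
  thus ?thesis by (simp add: U_def)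
qed

text \<open>\<open>V\<close> consists of the first three terms of the asymptotic expansion of
  \<psi>'''; the next term is negative, so the truncation bounds from above.\<close>

lemma Polygamma_3_upper:
  fixes z :: real
  assumes "z > 0"
  shows "Polygamma 3 z \<le> 2 / z ^ 3 + 3 / z ^ 4 + 2 / z ^ 5"
proof -
  define V where "V = (\<lambda>z::real. 2 / z ^ 3 + 3 / z ^ 4 + 2 / z ^ 5)"
  have step: "6 / w ^ 4 \<le> V w - V (w + 1)" if "w > 0" for w
  proof -
    have "V w - V (w + 1) - 6 / w ^ 4 =
        (7 * w\<^sup>2 + 7 * w + 2) / (w ^ 5 * (w + 1) ^ 5)"
      using that unfolding V_def by (simp add: divide_simps) algebra
    moreover have "\<dots> \<ge> 0" using that by simp
    ultimately show ?thesis by linarith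
  qed
  have "(\<lambda>k. V (z + real k)) \<longlonglongrightarrow> 0"
    unfolding V_def by real_asymp
  from sums_le_telescope[OF Polygamma_3_sums[OF assms] this] step[of "z + real _"] assms
  have "Polygamma 3 z \<le> V (z + real 0)"
    by (simp add: add_ac)
  thus ?thesis by (simp add: V_def)
qed

section \<open>The function \<open>Phi\<close>: derivative, subadditivity and dependence on the
  shift\<close>

definition Phi :: "real \<Rightarrow> real \<Rightarrow> real" where
  "Phi b y = y\<^sup>2 * Polygamma 1 (y + b + 1) - 2 * y * Digamma (y + b + 1) + 2 * ln \<bar>Gamma (y + b + 1)\<bar>"

text \<open>On positive arguments the logarithm agrees with \<open>ln_Gamma\<close>. The absolute
  value is there for vanishing coefficients, where the Gamma factor is a constant that may be
  negative.\<close>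

lemma has_real_derivative_ln_abs_Gamma:
  fixes z :: real
  assumes "z > 0"
  shows "((\<lambda>x. ln \<bar>Gamma x\<bar>) has_real_derivative Digamma z) (at z)"
  using has_field_derivative_ln_Gamma_real[OF assms]
  by (rule has_field_derivative_transform_within_open[of _ _ _ "{0<..}"])
     (use assms in \<open>auto simp: ln_Gamma_real_pos\<close>)

lemma has_real_derivative_Polygamma_chain:
  assumes "f x > (0::real)" "(f has_real_derivative f') (at x)"
  shows "((\<lambda>x. Polygamma n (f x)) has_real_derivative Polygamma (Suc n) (f x) * f') (at x)"
  by (rule DERIV_chain2[OF has_field_derivative_Polygamma assms(2)])
     (use assms(1) in \<open>auto elim!: nonpos_Ints_cases\<close>)

lemma has_real_derivative_ln_abs_Gamma_chain:
  assumes "f x > (0::real)" "(f has_real_derivative f') (at x)"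
  shows "((\<lambda>x. ln \<bar>Gamma (f x)\<bar>) has_real_derivative Digamma (f x) * f') (at x)"
  by (rule DERIV_chain2[OF has_real_derivative_ln_abs_Gamma assms(2)]) (rule assms(1))

lemma has_real_derivative_Phi:
  assumes "y + b + 1 > 0"
  shows "(Phi b has_real_derivative y\<^sup>2 * Polygamma 2 (y + b + 1)) (at y)"
  unfolding Phi_def [abs_def]
  by (rule derivative_eq_intros has_real_derivative_Polygamma_chain
        has_real_derivative_ln_abs_Gamma_chain assms refl)+
     (simp add: eval_nat_numeral algebra_simps)

lemma has_real_derivative_Phi_chain:
  assumes "g x + b + 1 > 0" "(g has_real_derivative g') (at x)"
  shows "((\<lambda>x. Phi b (g x)) has_real_derivative (g x)\<^sup>2 * Polygamma 2 (g x + b + 1) * g') (at x)"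
  by (rule DERIV_chain2[OF has_real_derivative_Phi assms(2)]) (rule assms(1))

text \<open>This expresses the concavity of \<open>Phi 0\<close> on the nonnegative reals: the
  function that decreases is its derivative.\<close>

lemma antimono_sq_mult_Polygamma_2:
  fixes y z :: real
  assumes "0 \<le> y" "y \<le> z"
  shows "z\<^sup>2 * Polygamma 2 (z + 1) \<le> y\<^sup>2 * Polygamma 2 (y + 1)"
proof (rule DERIV_nonpos_imp_nonincreasing[where f = "\<lambda>x. x\<^sup>2 * Polygamma 2 (x + 1)", OF assms(2)])
  fix x assume "y \<le> x" "x \<le> z"
  with assms have x: "x \<ge> 0" by simp
  define w where "w = x + 1"
  have w: "w \<ge> 1" "x = w - 1" using x by (auto simp: w_def)
  have "((\<lambda>x. x\<^sup>2 * Polygamma 2 (x + 1)) has_real_derivative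
      x * (2 * Polygamma 2 w + x * Polygamma 3 w)) (at x)"
    unfolding w_def using x
    by (auto intro!: derivative_eq_intros has_real_derivative_Polygamma_chain
          simp: eval_nat_numeral algebra_simps)
  moreover have "2 * Polygamma 2 w + x * Polygamma 3 w \<le> 0"
  proof -
    have "x * Polygamma 3 w \<le> x * (2 / w ^ 3 + 3 / w ^ 4 + 2 / w ^ 5)"
      using Polygamma_3_upper[of w] x w by (intro mult_left_mono) auto
    moreover have "2 * Polygamma 2 w \<le> - 2 * (1 / w\<^sup>2 + 1 / w ^ 3)"
      using Polygamma_2_upper[of w] w by simp
    \<comment> \<open>With \<open>x = w - 1\<close> the leading terms 2/w^2 cancel, and everything
      that remains is negative.\<close>
    moreover have "- 2 * (1 / w\<^sup>2 + 1 / w ^ 3) + x * (2 / w ^ 3 + 3 / w ^ 4 + 2 / w ^ 5) =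
        - (1 / w ^ 3 + 1 / w ^ 4 + 2 / w ^ 5)"
      using w(1) unfolding w(2) by (simp add: divide_simps) algebra
    moreover have "1 / w ^ 3 + 1 / w ^ 4 + 2 / w ^ 5 \<ge> 0"
      using w(1) by simp
    ultimately show ?thesis by linarith
  qed
  ultimately show "\<exists>D. ((\<lambda>x. x\<^sup>2 * Polygamma 2 (x + 1)) has_real_derivative D) (at x) \<and> D \<le> 0"
    using x by (blast intro: mult_nonneg_nonpos)
qed

text \<open>By concavity the increment over a fixed step \<open>z\<close> shrinks as its starting
  point moves from 0 to \<open>y\<close>; at the starting point 0 it equals \<open>Phi 0 z\<close>,
  since \<open>Phi 0 0 = 0\<close>.\<close>

lemma Phi_0_subadditive:
  assumes "0 \<le> y" "0 \<le> z"
  shows "Phi 0 (z + y) \<le> Phi 0 z + Phi 0 y"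
proof -
  have "Phi 0 (z + y) - Phi 0 y \<le> Phi 0 (z + 0) - Phi 0 0"
  proof (rule DERIV_nonpos_imp_nonincreasing[where f = "\<lambda>x. Phi 0 (z + x) - Phi 0 x", OF assms(1)])
    fix x assume x: "0 \<le> x" "x \<le> y"
    have "((\<lambda>x. Phi 0 (z + x) - Phi 0 x) has_real_derivative
        (z + x)\<^sup>2 * Polygamma 2 (z + x + 1) - x\<^sup>2 * Polygamma 2 (x + 1)) (at x)"
      using x assms by (auto intro!: derivative_eq_intros has_real_derivative_Phi_chain has_real_derivative_Phi)
    moreover have "(z + x)\<^sup>2 * Polygamma 2 (z + x + 1) - x\<^sup>2 * Polygamma 2 (x + 1) \<le> 0"
      using antimono_sq_mult_Polygamma_2[of x "z + x"] x assms by simp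
    ultimately show "\<exists>D. ((\<lambda>x. Phi 0 (z + x) - Phi 0 x) has_real_derivative D) (at x) \<and> D \<le> 0"
      by blast
  qed
  moreover have "Phi 0 0 = 0" by (simp add: Phi_def)
  ultimately show ?thesis by simp
qed

text \<open>The difference of the two sides has a derivative of constant sign, so the comparison
  reduces to the starting value at 0.\<close>

lemma Phi_0_le_Phi:
  assumes "0 \<le> y" "1 \<le> f"
  shows "Phi 0 y \<le> Phi f y"
proof -
  have "Phi 0 y - Phi f y \<le> Phi 0 0 - Phi f 0"
  proof (rule DERIV_nonpos_imp_nonincreasing[where f = "\<lambda>x. Phi 0 x - Phi f x", OF assms(1)])
    fix x assume x: "0 \<le> x" "x \<le> y"
    have "((\<lambda>x. Phi 0 x - Phi f x) has_real_derivative
        x\<^sup>2 * Polygamma 2 (x + 1) - x\<^sup>2 * Polygamma 2 (x + f + 1)) (at x)"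
      using has_real_derivative_Phi[of x 0] has_real_derivative_Phi[of x f] x assms
      by (auto intro!: derivative_eq_intros)
    moreover have "Polygamma 2 (x + 1) \<le> Polygamma 2 (x + f + 1)"
      using x assms by (intro Polygamma_real_mono) auto
    hence "x\<^sup>2 * Polygamma 2 (x + 1) - x\<^sup>2 * Polygamma 2 (x + f + 1) \<le> 0"
      by (simp add: mult_left_mono)
    ultimately show "\<exists>D. ((\<lambda>x. Phi 0 x - Phi f x) has_real_derivative D) (at x) \<and> D \<le> 0"
      by blast
  qed
  \<comment> \<open>Here \<open>f \<ge> 1\<close> enters: Gamma is at least 1 from the argument 2
    on, while it is below 1 strictly between 1 and 2.\<close>
  moreover have "Gamma (f + 1) \<ge> 1"
    using Gamma_real_strict_mono[of 2 "f + 1"] assms Gamma_fact[of 1, where 'a = real]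
    by (cases "f = 1") (auto simp: Gamma_numeral)
  hence "Phi 0 0 \<le> Phi f 0" by (simp add: Phi_def)
  ultimately show ?thesis by simp
qed

section \<open>Asymptotics of the derivative and the eventual sign of the numerator\<close>

lemma cube_mult_Polygamma_2_asymp:
  fixes b :: real
  shows "((\<lambda>y. y ^ 3 * Polygamma 2 (y + b + 1) + y) \<longlongrightarrow> 2 * b + 1) at_top"
proof (rule tendsto_sandwich)
  let ?T = "\<lambda>y::real. 1 / (y + b + 1)\<^sup>2 + 1 / (y + b + 1) ^ 3"
  \<comment> \<open>The extra summand of the lower bound contributes a term of order 1/y, so both
    bounds have the same limit.\<close>
  show "((\<lambda>y. y - y ^ 3 * (?T y + 1 / (y + b + 1) ^ 4)) \<longlongrightarrow> 2 * b + 1) at_top"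
    by real_asymp
  show "((\<lambda>y. y - y ^ 3 * ?T y) \<longlongrightarrow> 2 * b + 1) at_top"
    by real_asymp
  have ev: "eventually (\<lambda>y. y > 0 \<and> y + b + 1 > 0) at_top"
    using eventually_gt_at_top[of "max 0 (- b - 1)"] by eventually_elim auto
  show "eventually (\<lambda>y. y - y ^ 3 * (?T y + 1 / (y + b + 1) ^ 4) \<le>
      y ^ 3 * Polygamma 2 (y + b + 1) + y) at_top"
    using ev
  proof eventually_elim
    case (elim y)
    show ?case
      using mult_left_mono[OF Polygamma_2_lower[of "y + b + 1"], of "y ^ 3"] elim
      unfolding mult_minus_right by auto
  qed
  show "eventually (\<lambda>y. y ^ 3 * Polygamma 2 (y + b + 1) + y \<le> y - y ^ 3 * ?T y) at_top"
    using ev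
  proof eventually_elim
    case (elim y)
    show ?case
      using mult_left_mono[OF Polygamma_2_upper[of "y + b + 1"], of "y ^ 3"] elim
      unfolding mult_minus_right by auto
  qed
qed

text \<open>Substituting \<open>a * x\<close> for \<open>y\<close> in the previous limit gives
  \<open>x\<close> times the derivative of \<open>Phi b (a * x)\<close>. For \<open>a = 0\<close>
  the expression vanishes identically, which accounts for the case distinction in the limit.\<close>

lemma Phi_mult_deriv_asymp:
  fixes a b :: real
  assumes "a \<ge> 0"
  shows "((\<lambda>x. x * (a * ((a * x)\<^sup>2 * Polygamma 2 (a * x + b + 1))) + a * x) \<longlongrightarrow>
           (if a = 0 then 0 else 2 * b + 1)) at_top"
proof (cases "a = 0")
  case False
  with assms have "a > 0" by simp
  hence "filterlim (\<lambda>x. a * x) at_top at_top"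
    by real_asymp
  from filterlim_compose[OF cube_mult_Polygamma_2_asymp this, of b] False show ?thesis
    by (simp add: power2_eq_square power3_eq_cube mult_ac)
qed simp

text \<open>Since g' is eventually at least \<kappa>/x, the function g - \<kappa> ln is
  nondecreasing from some point on, so g is bounded below by a constant plus \<kappa> ln x.\<close>

lemma eventually_pos_if_log_growth:
  fixes g g' :: "real \<Rightarrow> real"
  assumes deriv: "eventually (\<lambda>x. (g has_real_derivative g' x) (at x)) at_top"
    and \<kappa>: "\<kappa> > 0" "eventually (\<lambda>x. x * g' x \<ge> \<kappa>) at_top"
  shows "eventually (\<lambda>x. g x > 0) at_top"
proof -
  obtain X where X: "X > 0" "\<And>x. x \<ge> X \<Longrightarrow> (g has_real_derivative g' x) (at x)"
    "\<And>x. x \<ge> X \<Longrightarrow> x * g' x \<ge> \<kappa>"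
    using eventually_conj[OF eventually_conj[OF deriv \<kappa>(2)] eventually_gt_at_top[of 0]]
    unfolding eventually_at_top_linorder by (metis order_refl)
  have le: "g X - \<kappa> * ln X \<le> g x - \<kappa> * ln x" if "X \<le> x" for x
  proof (rule DERIV_nonneg_imp_nondecreasing[where f = "\<lambda>x. g x - \<kappa> * ln x", OF that])
    fix t assume t: "X \<le> t" "t \<le> x"
    have "((\<lambda>x. g x - \<kappa> * ln x) has_real_derivative g' t - \<kappa> / t) (at t)"
      using t X(1) by (auto intro!: derivative_eq_intros X(2))
    moreover have "g' t - \<kappa> / t \<ge> 0"
      using X(1) X(3)[OF t(1)] t(1) by (simp add: field_simps)
    ultimately show "\<exists>D. ((\<lambda>x. g x - \<kappa> * ln x) has_real_derivative D) (at t) \<and> D \<ge> 0"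
      by blast
  qed
  have "filterlim (\<lambda>x. g X - \<kappa> * ln X + \<kappa> * ln x) at_top at_top"
    using \<kappa>(1) by real_asymp
  hence "eventually (\<lambda>x. g X - \<kappa> * ln X + \<kappa> * ln x > 0) at_top"
    by (simp add: filterlim_at_top_dense)
  with eventually_ge_at_top[of X] show ?thesis
    by eventually_elim (use le in force)
qed

text \<open>The alternative \<open>a = 0\<close> is kept apart because the argument is then the
  constant \<open>b + 1\<close>, of unknown sign; the function of \<open>x\<close> is constant too,
  so differentiating it is no problem.\<close>

lemma eventually_Gamma_arg_pos:
  fixes a b :: real
  assumes "a \<ge> 0"
  shows "eventually (\<lambda>x. a = 0 \<or> a * x + b + 1 > 0) at_top"
proof (cases "a = 0")
  case False
  with assms have "a > 0" by simp
  hence "filterlim (\<lambda>x. a * x + b + 1) at_top at_top" by real_asymp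
  thus ?thesis by (auto simp: filterlim_at_top_dense elim: eventually_mono)
qed simp

lemma has_real_derivative_Phi_mult:
  assumes "a = 0 \<or> a * x + b + 1 > 0"
  shows "((\<lambda>x. Phi b (a * x)) has_real_derivative
           a * ((a * x)\<^sup>2 * Polygamma 2 (a * x + b + 1))) (at x)"
proof (cases "a = 0")
  case False
  have "((\<lambda>x. Phi b (a * x)) has_real_derivative
      (a * x)\<^sup>2 * Polygamma 2 (a * x + b + 1) * a) (at x)"
    using False assms
    by (intro has_real_derivative_Phi_chain) (auto intro!: derivative_eq_intros)
  thus ?thesis by (simp add: mult_ac)
qed simp

text \<open>\<open>\<sigma> = -1\<close> serves the concave and \<open>\<sigma> = 1\<close> the convex case.\<close>

lemma eventually_Phi_combination_pos:
  fixes \<sigma> a b c d e f :: real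
  assumes nonneg: "a \<ge> 0" "c \<ge> 0" "e \<ge> 0"
    and cases: "\<sigma> * (a - c - e) < 0 \<or> a = c + e \<and>
      \<sigma> * ((if a = 0 then 0 else 2 * b + 1) - (if c = 0 then 0 else 2 * d + 1)
         - (if e = 0 then 0 else 2 * f + 1)) > 0"
  shows "eventually (\<lambda>x. \<sigma> * (Phi b (a * x) - Phi d (c * x) - Phi f (e * x)) > 0) at_top"
proof -
  define D where "D = (\<lambda>(a::real) b x. a * ((a * x)\<^sup>2 * Polygamma 2 (a * x + b + 1)))"
  define r where "r = (\<lambda>a b::real. if a = (0::real) then 0 else 2 * b + 1)"
  \<comment> \<open>The added linear terms compensate the leading terms of the three derivatives, so
    that \<open>R\<close> converges to \<open>s\<close>.\<close>
  define R where "R = (\<lambda>x. \<sigma> * ((x * D a b x + a * x) - (x * D c d x + c * x) - (x * D e f x + e * x)))"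
  define s where "s = \<sigma> * (r a b - r c d - r e f)"
  have "(R \<longlongrightarrow> s) at_top"
    unfolding R_def D_def r_def s_def by (intro tendsto_intros Phi_mult_deriv_asymp nonneg)
  have eq: "x * (\<sigma> * (D a b x - D c d x - D e f x)) = R x - \<sigma> * (a - c - e) * x" for x
    by (simp add: R_def algebra_simps)
  have "\<exists>\<kappa>>0. eventually (\<lambda>x. R x - \<sigma> * (a - c - e) * x \<ge> \<kappa>) at_top"
    using cases
  proof
    \<comment> \<open>The linear term tends to infinity and outweighs the convergent
      \<open>R\<close>, so the bound 1 can be chosen.\<close>
    assume neg: "\<sigma> * (a - c - e) < 0"
    have "filterlim (\<lambda>x. - (\<sigma> * (a - c - e)) * x) at_top at_top"
      using neg by (intro filterlim_tendsto_pos_mult_at_top[OF tendsto_const _ filterlim_ident]) auto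
    from filterlim_tendsto_add_at_top[OF \<open>(R \<longlongrightarrow> s) at_top\<close> this]
    have "eventually (\<lambda>x. R x - \<sigma> * (a - c - e) * x \<ge> 1) at_top"
      by (simp add: filterlim_at_top)
    thus ?thesis by (intro exI[of _ 1]) auto
  next
    assume bal: "a = c + e \<and> \<sigma> * ((if a = 0 then 0 else 2 * b + 1)
      - (if c = 0 then 0 else 2 * d + 1) - (if e = 0 then 0 else 2 * f + 1)) > 0"
    \<comment> \<open>For \<open>a = c + e\<close> the linear term disappears and \<open>R\<close>
      alone decides; half of its positive limit serves as \<kappa>.\<close>
    hence "s > 0" unfolding s_def r_def by blast
    with order_tendstoD(1)[OF \<open>(R \<longlongrightarrow> s) at_top\<close>, of "s / 2"]
    have "eventually (\<lambda>x. R x \<ge> s / 2) at_top"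
      by (auto elim: eventually_mono)
    with \<open>s > 0\<close> bal show ?thesis by (intro exI[of _ "s / 2"]) auto
  qed
  then obtain \<kappa> where \<kappa>: "\<kappa> > 0" "eventually (\<lambda>x. x * (\<sigma> * (D a b x - D c d x - D e f x)) \<ge> \<kappa>) at_top"
    unfolding eq by blast
  have "eventually (\<lambda>x. ((\<lambda>x. \<sigma> * (Phi b (a * x) - Phi d (c * x) - Phi f (e * x)))
      has_real_derivative \<sigma> * (D a b x - D c d x - D e f x)) (at x)) at_top"
    using eventually_Gamma_arg_pos[OF nonneg(1), of b] eventually_Gamma_arg_pos[OF nonneg(2), of d]
      eventually_Gamma_arg_pos[OF nonneg(3), of f]
  proof eventually_elim
    case (elim x)
    show ?case unfolding D_def
      by (intro DERIV_cmult DERIV_diff has_real_derivative_Phi_mult elim)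
  qed
  from eventually_pos_if_log_growth[OF this \<kappa>] show ?thesis .
qed

section \<open>The second derivative of the logarithm of the root\<close>

lemma has_real_derivative_ln_abs_Gamma_mult:
  assumes "a = 0 \<or> a * x + b + 1 > 0"
  shows "((\<lambda>x. ln \<bar>Gamma (a * x + b + 1)\<bar>) has_real_derivative a * Digamma (a * x + b + 1)) (at x)"
proof (cases "a = 0")
  case False
  have "((\<lambda>x. ln \<bar>Gamma (a * x + b + 1)\<bar>) has_real_derivative Digamma (a * x + b + 1) * a) (at x)"
    using False assms
    by (intro has_real_derivative_ln_abs_Gamma_chain) (auto intro!: derivative_eq_intros)
  thus ?thesis by (simp add: mult_ac)
qed simp

lemma has_real_derivative_Digamma_mult:
  assumes "a = 0 \<or> a * x + b + 1 > 0"
  shows "((\<lambda>x. a * Digamma (a * x + b + 1)) has_real_derivative a\<^sup>2 * Polygamma 1 (a * x + b + 1)) (at x)"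
proof (cases "a = 0")
  case False
  have "((\<lambda>x. Digamma (a * x + b + 1)) has_real_derivative Polygamma (Suc 0) (a * x + b + 1) * a) (at x)"
    using False assms
    by (intro has_real_derivative_Polygamma_chain) (auto intro!: derivative_eq_intros)
  from DERIV_cmult[OF this, of a] show ?thesis by (simp add: power2_eq_square mult_ac)
qed simp

text \<open>The second derivative of l/x is l''/x - 2 l'/x^2 + 2 l/x^3. Over the common denominator
  x^3 its numerator is \<open>Phi b (a * x)\<close>, which explains the form of
  \<open>Phi\<close>.\<close>

lemma ln_abs_Gamma_over_x_derivs:
  fixes a b x :: real
  defines "l \<equiv> \<lambda>x. ln \<bar>Gamma (a * x + b + 1)\<bar>"
    and "\<psi> \<equiv> \<lambda>x. a * Digamma (a * x + b + 1)"
  assumes "x > 0" "a = 0 \<or> a * x + b + 1 > 0"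
  shows "((\<lambda>x. l x / x) has_real_derivative \<psi> x / x - l x / x\<^sup>2) (at x)"
    and "((\<lambda>x. \<psi> x / x - l x / x\<^sup>2) has_real_derivative Phi b (a * x) / x ^ 3) (at x)"
proof -
  have l: "(l has_real_derivative \<psi> x) (at x)"
    unfolding l_def \<psi>_def by (rule has_real_derivative_ln_abs_Gamma_mult[OF assms(4)])
  have \<psi>: "(\<psi> has_real_derivative a\<^sup>2 * Polygamma 1 (a * x + b + 1)) (at x)"
    unfolding \<psi>_def by (rule has_real_derivative_Digamma_mult[OF assms(4)])
  show "((\<lambda>x. l x / x) has_real_derivative \<psi> x / x - l x / x\<^sup>2) (at x)"
    by (rule derivative_eq_intros l refl)+
       (use assms(3) in \<open>auto simp: field_simps power2_eq_square\<close>)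
  have "(a\<^sup>2 * Polygamma 1 (a * x + b + 1) * x - \<psi> x) / (x * x) -
      (\<psi> x * x\<^sup>2 - l x * (2 * x)) / (x\<^sup>2 * x\<^sup>2) = Phi b (a * x) / x ^ 3"
    using assms(3) unfolding Phi_def l_def \<psi>_def
    by (simp add: divide_simps) algebra
  thus "((\<lambda>x. \<psi> x / x - l x / x\<^sup>2) has_real_derivative Phi b (a * x) / x ^ 3) (at x)"
    using assms(3) by (auto intro!: derivative_eq_intros l \<psi>)
qed

lemma ln_Gamma_root:
  assumes "Gamma_ratio a b c d e f x > 0"
  shows "ln (Gamma_root a b c d e f x) = ln \<bar>Gamma (a * x + b + 1)\<bar> / x
    - ln \<bar>Gamma (c * x + d + 1)\<bar> / x - ln \<bar>Gamma (e * x + f + 1)\<bar> / x"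
proof -
  \<comment> \<open>At a pole Gamma has the default value 0, which would make the ratio 0. The
    single factors may still be negative, hence the absolute values.\<close>
  have nz: "Gamma (a * x + b + 1) \<noteq> 0" "Gamma (c * x + d + 1) \<noteq> 0" "Gamma (e * x + f + 1) \<noteq> 0"
    using assms by (auto simp: Gamma_ratio_def)
  have "ln (Gamma_ratio a b c d e f x) = ln \<bar>Gamma_ratio a b c d e f x\<bar>"
    using assms by simp
  also have "\<dots> = ln \<bar>Gamma (a * x + b + 1)\<bar> - ln \<bar>Gamma (c * x + d + 1)\<bar>
      - ln \<bar>Gamma (e * x + f + 1)\<bar>"
    using nz by (simp add: Gamma_ratio_def abs_mult ln_div ln_mult)
  finally show ?thesis
    using assms by (simp add: Gamma_root_def ln_powr diff_divide_distrib)
qed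

lemma convex_on_transform:
  fixes f g :: "'a::real_vector \<Rightarrow> real"
  assumes "convex_on S f" "\<And>x. x \<in> S \<Longrightarrow> f x = g x"
  shows "convex_on S g"
  unfolding convex_on_def
proof (intro conjI ballI allI impI)
  show "convex S" using assms(1) by (simp add: convex_on_def)
  fix x y :: 'a and u v :: real
  assume xy: "x \<in> S" "y \<in> S" and uv: "0 \<le> u" "0 \<le> v" "u + v = 1"
  have "u *\<^sub>R x + v *\<^sub>R y \<in> S" using convexD[OF \<open>convex S\<close> xy uv] .
  with assms(1) xy uv show "g (u *\<^sub>R x + v *\<^sub>R y) \<le> u * g x + v * g y"
    by (simp add: convex_on_def assms(2)[symmetric])
qed

text \<open>The second derivative of the logarithm is the combination of \<open>Phi\<close> values
  divided by x^3, and x^3 is positive from \<open>X\<close> on, so \<open>sign\<close> is exactly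
  the second-derivative test.\<close>

lemma Gamma_root_convexity:
  fixes \<sigma> X :: real
  assumes X: "X > 0"
    and ratio: "\<And>x. x \<ge> X \<Longrightarrow> Gamma_ratio a b c d e f x > 0"
    and arg: "\<And>x. x \<ge> X \<Longrightarrow> a = 0 \<or> a * x + b + 1 > 0"
      "\<And>x. x \<ge> X \<Longrightarrow> c = 0 \<or> c * x + d + 1 > 0"
      "\<And>x. x \<ge> X \<Longrightarrow> e = 0 \<or> e * x + f + 1 > 0"
    and sign: "\<And>x. x \<ge> X \<Longrightarrow> \<sigma> * (Phi b (a * x) - Phi d (c * x) - Phi f (e * x)) \<ge> 0"
  shows "\<forall>x\<in>{X..}. Gamma_root a b c d e f x > 0"
    and "convex_on {X..} (\<lambda>x. \<sigma> * ln (Gamma_root a b c d e f x))"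
proof -
  show "\<forall>x\<in>{X..}. Gamma_root a b c d e f x > 0"
    using ratio by (force simp: Gamma_root_def)
  define l where "l = (\<lambda>(a::real) b x. ln \<bar>Gamma (a * x + b + 1)\<bar>)"
  define l' where "l' = (\<lambda>(a::real) b x. a * Digamma (a * x + b + 1) / x - l a b x / x\<^sup>2)"
  have "convex_on {X..} (\<lambda>x. \<sigma> * (l a b x / x - l c d x / x - l e f x / x))"
  proof (rule f''_ge0_imp_convex)
    fix x assume "x \<in> {X..}"
    hence x: "x \<ge> X" "x > 0" using X by auto
    note derivs = ln_abs_Gamma_over_x_derivs[OF x(2)]
    show "((\<lambda>x. \<sigma> * (l a b x / x - l c d x / x - l e f x / x)) has_real_derivative
        \<sigma> * (l' a b x - l' c d x - l' e f x)) (at x)"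
      unfolding l'_def l_def by (intro DERIV_cmult DERIV_diff derivs arg x)
    show "((\<lambda>x. \<sigma> * (l' a b x - l' c d x - l' e f x)) has_real_derivative
        \<sigma> * (Phi b (a * x) / x ^ 3 - Phi d (c * x) / x ^ 3 - Phi f (e * x) / x ^ 3)) (at x)"
      unfolding l'_def l_def by (intro DERIV_cmult DERIV_diff derivs arg x)
    have "\<sigma> * (Phi b (a * x) / x ^ 3 - Phi d (c * x) / x ^ 3 - Phi f (e * x) / x ^ 3) =
        \<sigma> * (Phi b (a * x) - Phi d (c * x) - Phi f (e * x)) / x ^ 3"
      by (simp add: diff_divide_distrib right_diff_distrib)
    thus "\<sigma> * (Phi b (a * x) / x ^ 3 - Phi d (c * x) / x ^ 3 - Phi f (e * x) / x ^ 3) \<ge> 0"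
      using sign[OF x(1)] x(2) by simp
  qed simp
  thus "convex_on {X..} (\<lambda>x. \<sigma> * ln (Gamma_root a b c d e f x))"
    by (rule convex_on_transform) (auto simp: ln_Gamma_root ratio l_def)
qed

text \<open>If all coefficients are positive, the Gamma arguments tend to infinity and the ratio is
  eventually positive. A vanishing coefficient freezes its Gamma factor, possibly at a pole or a
  negative value; \<open>well_defined\<close> excludes a bad outcome.\<close>

lemma eventually_Gamma_root_convexity:
  fixes \<sigma> a b c d e f :: real
  assumes nonneg: "a \<ge> 0" "c \<ge> 0" "e \<ge> 0"
    and well_defined: "a = 0 \<or> c = 0 \<or> e = 0 \<longrightarrow>
      (\<forall>\<^sub>F x in at_top. Gamma_ratio a b c d e f x > 0)"
    and cases: "\<sigma> * (a - c - e) < 0 \<or> a = c + e \<and>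
      \<sigma> * ((if a = 0 then 0 else 2 * b + 1) - (if c = 0 then 0 else 2 * d + 1)
         - (if e = 0 then 0 else 2 * f + 1)) > 0"
  obtains X where "\<forall>x\<in>{X..}. Gamma_root a b c d e f x > 0"
    "convex_on {X..} (\<lambda>x. \<sigma> * ln (Gamma_root a b c d e f x))"
proof -
  note arg = eventually_Gamma_arg_pos[OF nonneg(1), of b] eventually_Gamma_arg_pos[OF nonneg(2), of d]
    eventually_Gamma_arg_pos[OF nonneg(3), of f]
  have ratio: "\<forall>\<^sub>F x in at_top. Gamma_ratio a b c d e f x > 0"
  proof (cases "a = 0 \<or> c = 0 \<or> e = 0")
    case False
    show ?thesis using arg
      by eventually_elim (use False in \<open>auto simp: Gamma_ratio_def\<close>)
  qed (use well_defined in blast)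
  have "\<forall>\<^sub>F x in at_top. x > 0 \<and> Gamma_ratio a b c d e f x > 0 \<and>
      (a = 0 \<or> a * x + b + 1 > 0) \<and> (c = 0 \<or> c * x + d + 1 > 0) \<and> (e = 0 \<or> e * x + f + 1 > 0) \<and>
      \<sigma> * (Phi b (a * x) - Phi d (c * x) - Phi f (e * x)) > 0"
    by (intro eventually_conj eventually_gt_at_top ratio arg eventually_Phi_combination_pos nonneg cases)
  then obtain X where X: "\<And>x. x \<ge> X \<Longrightarrow> x > 0 \<and> Gamma_ratio a b c d e f x > 0 \<and>
      (a = 0 \<or> a * x + b + 1 > 0) \<and> (c = 0 \<or> c * x + d + 1 > 0) \<and> (e = 0 \<or> e * x + f + 1 > 0) \<and>
      \<sigma> * (Phi b (a * x) - Phi d (c * x) - Phi f (e * x)) > 0"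
    unfolding eventually_at_top_linorder by blast
  show thesis
    by (rule that[of X]; rule Gamma_root_convexity) (use X in \<open>auto intro: less_imp_le\<close>)
qed

text \<open>Subadditivity splits \<open>Phi 0\<close> at \<open>c * x\<close> and
  \<open>e * x\<close>, and the second summand is then compared with \<open>Phi f\<close>. Both
  explicit ranges of the theorem are instances.\<close>

lemma log_concave_on_Gamma_root:
  fixes X :: real
  assumes "X > 0" "c \<ge> 0" "e \<ge> 0" "f = 0 \<or> f \<ge> 1"
  shows "log_concave_on {X..} (Gamma_root (c + e) 0 c 0 e f)"
proof -
  have pos: "(c + e) * x + 0 + 1 > 0" "c * x + 0 + 1 > 0" "e * x + f + 1 > 0" if "x \<ge> X" for x
    using that assms by (auto intro!: add_nonneg_pos simp: add.assoc)
  have ratio: "Gamma_ratio (c + e) 0 c 0 e f x > 0" if "x \<ge> X" for x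
    using pos[OF that] by (auto simp: Gamma_ratio_def intro!: divide_pos_pos mult_pos_pos)
  have sign: "- 1 * (Phi 0 ((c + e) * x) - Phi 0 (c * x) - Phi f (e * x)) \<ge> 0" if "x \<ge> X" for x
  proof -
    have nonneg: "c * x \<ge> 0" "e * x \<ge> 0" using that assms by auto
    have "Phi 0 (c * x + e * x) \<le> Phi 0 (c * x) + Phi 0 (e * x)"
      by (intro Phi_0_subadditive nonneg)
    moreover have "Phi 0 (e * x) \<le> Phi f (e * x)"
      using assms(4) Phi_0_le_Phi[OF nonneg(2)] by auto
    ultimately show ?thesis by (simp add: distrib_right)
  qed
  from Gamma_root_convexity[OF assms(1) ratio _ _ _ sign] pos show ?thesis
    by (simp add: log_concave_on_def concave_on_def)
qed

section \<open>Reduction of the cases to the sign conditions\<close>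

theorem theorem3p6:
  fixes a b c d e f :: real
  assumes nonneg: "a \<ge> 0" "c \<ge> 0" "e \<ge> 0"
    and well_defined: "a = 0 \<or> c = 0 \<or> e = 0 \<longrightarrow>
      (\<forall>\<^sub>F x in at_top. Gamma_ratio a b c d e f x > 0)"
  shows
    "(a > c + e \<longrightarrow> asymptotically_log_concave (Gamma_root a b c d e f)) \<and>
     (a = c + e \<and> c \<ge> e \<and> e > 0 \<longrightarrow>
        (b < d + f + 1/2 \<longrightarrow> asymptotically_log_concave (Gamma_root a b c d e f)) \<and>
        (c \<ge> 1 \<and> b = 0 \<and> d = 0 \<and> f = 0 \<longrightarrow>
           log_concave_on {30..} (Gamma_root a b c d e f)) \<and>
        (c \<ge> 1 \<and> b = 0 \<and> d = 0 \<and> f \<ge> 1 \<longrightarrow>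
           log_concave_on {2..} (Gamma_root a b c d e f))) \<and>
     (a = c + e \<and> c > e \<and> e = 0 \<and> b < d \<longrightarrow>
        asymptotically_log_concave (Gamma_root a b c d e f)) \<and>
     (a < c + e \<longrightarrow> asymptotically_log_convex (Gamma_root a b c d e f))"
proof -
  note convexity = eventually_Gamma_root_convexity[OF nonneg well_defined]
  have concave: "asymptotically_log_concave (Gamma_root a b c d e f)"
    if "a > c + e \<or> a = c + e \<and> ((if a = 0 then 0 else 2 * b + 1) -
      (if c = 0 then 0 else 2 * d + 1) - (if e = 0 then 0 else 2 * f + 1)) < 0"
  proof -
    have "- 1 * (a - c - e) < 0 \<or> a = c + e \<and> - 1 * ((if a = 0 then 0 else 2 * b + 1) -
        (if c = 0 then 0 else 2 * d + 1) - (if e = 0 then 0 else 2 * f + 1)) > 0"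
      using that by argo
    from convexity[OF this] obtain X where "\<forall>x\<in>{X..}. Gamma_root a b c d e f x > 0"
      "convex_on {X..} (\<lambda>x. - 1 * ln (Gamma_root a b c d e f x))" .
    thus ?thesis
      unfolding asymptotically_log_concave_def log_concave_on_def concave_on_def by auto
  qed
  have convex: "asymptotically_log_convex (Gamma_root a b c d e f)" if "a < c + e"
  proof -
    from that have "1 * (a - c - e) < 0" by simp
    from convexity[OF disjI1[OF this]] obtain X where "\<forall>x\<in>{X..}. Gamma_root a b c d e f x > 0"
      "convex_on {X..} (\<lambda>x. 1 * ln (Gamma_root a b c d e f x))" .
    thus ?thesis
      unfolding asymptotically_log_convex_def log_convex_on_def by auto
  qed
  show ?thesis
  proof (intro conjI impI)
    assume "a > c + e"
    thus "asymptotically_log_concave (Gamma_root a b c d e f)" by (intro concave) simp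
  next
    assume "a = c + e \<and> c \<ge> e \<and> e > 0" "b < d + f + 1/2"
    \<comment> \<open>All coefficients are positive, so the balance is (2b+1) - (2d+1) - (2f+1) =
      2(b-d-f) - 1, negative exactly for \<open>b < d + f + 1/2\<close>.\<close>
    thus "asymptotically_log_concave (Gamma_root a b c d e f)" by (intro concave) auto
  next
    assume "a = c + e \<and> c \<ge> e \<and> e > 0" "c \<ge> 1 \<and> b = 0 \<and> d = 0 \<and> f = 0"
    thus "log_concave_on {30..} (Gamma_root a b c d e f)"
      using log_concave_on_Gamma_root[of 30 c e f] by simp
  next
    assume "a = c + e \<and> c \<ge> e \<and> e > 0" "c \<ge> 1 \<and> b = 0 \<and> d = 0 \<and> f \<ge> 1"
    thus "log_concave_on {2..} (Gamma_root a b c d e f)"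
      using log_concave_on_Gamma_root[of 2 c e f] by simp
  next
    assume "a = c + e \<and> c > e \<and> e = 0 \<and> b < d"
    \<comment> \<open>With \<open>e = 0\<close> the contribution of \<open>f\<close> drops out and
      the balance is 2(b-d).\<close>
    thus "asymptotically_log_concave (Gamma_root a b c d e f)" by (intro concave) auto
  next
    assume "a < c + e"
    thus "asymptotically_log_convex (Gamma_root a b c d e f)" by (rule convex)
  qed
qed

end
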